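(* Let $G$ be a finitely generated group that admits infinitely many finite conjugacy classes. Then, for any $C_0$-representation $\pi$ of $G$, the reduced first cohomology vanishes: $$\overline{H^1}(G,\pi)=0.$$
   Context: A $C_0$-representation of the countable discrete group $G$ is a unitary representation $\pi$ on a Hilbert space $\mathcal{H}$ all of whose coefficients $g\mapsto\langle\pi(g)x,y\rangle$ ($x,y\in\mathcal{H}$) are $C_0$ functions, i.e. for every $\epsilon>0$ they have modulus strictly smaller than $\epsilon$ outside a finite subset of $G$. $Z^1(G,\pi)$ is the space of maps $b:G\to\mathcal{H}$ with $b(gh)=\pi(g)b(h)+b(g)$; $B^1(G,\pi)$ is the subspace of maps $g\mapsto(\pi(g)-1)v$, $v\in\mathcal{H}$; and $\overline{H^1}(G,\pi)=Z^1(G,\pi)/\overline{B^1(G,\pi)}$, the closure being taken for uniform convergence on compact (here: finite) subsets of $G$. *)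

theory Defs
  imports
    "HOL-Analysis.Analysis"
    "HOL-Algebra.Generated_Groups"
    "HOL-Algebra.Elementary_Groups"
begin

section \<open>Complex Hilbert spaces\<close>

text \<open>The inner product is linear in the first argument. The axiom \<open>cinner_self\<close> makes the form
  positive definite and identifies the given norm with the one it induces.\<close>

class complex_inner = real_normed_vector +
  fixes scaleC :: "complex \<Rightarrow> 'a \<Rightarrow> 'a"
    and cinner :: "'a \<Rightarrow> 'a \<Rightarrow> complex"
  assumes scaleC_of_real: "scaleC (complex_of_real r) x = r *\<^sub>R x"
    and scaleC_add_right: "scaleC a (x + y) = scaleC a x + scaleC a y"
    and scaleC_add_left: "scaleC (a + b) x = scaleC a x + scaleC b x"
    and scaleC_scaleC: "scaleC a (scaleC b x) = scaleC (a * b) x"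
    and cinner_commute: "cinner x y = cnj (cinner y x)"
    and cinner_add_left: "cinner (x + y) z = cinner x z + cinner y z"
    and cinner_scaleC_left: "cinner (scaleC a x) y = a * cinner x y"
    and cinner_self: "cinner x x = complex_of_real ((norm x)\<^sup>2)"

class complex_hilbert_space = complex_inner + complete_space

instantiation complex :: complex_hilbert_space
begin

definition scaleC_complex :: "complex \<Rightarrow> complex \<Rightarrow> complex"
  where "scaleC_complex a x = a * x"

definition cinner_complex :: "complex \<Rightarrow> complex \<Rightarrow> complex"
  where "cinner_complex x y = x * cnj y"

instance
proof
  fix r :: real and a b x y z :: complex
  show "scaleC (complex_of_real r) x = r *\<^sub>R x"
    by (simp add: scaleC_complex_def scaleR_conv_of_real)
  show "scaleC a (x + y) = scaleC a x + scaleC a y"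
    by (simp add: scaleC_complex_def distrib_left)
  show "scaleC (a + b) x = scaleC a x + scaleC b x"
    by (simp add: scaleC_complex_def distrib_right)
  show "scaleC a (scaleC b x) = scaleC (a * b) x"
    by (simp add: scaleC_complex_def mult.assoc)
  show "cinner x y = cnj (cinner y x)"
    by (simp add: cinner_complex_def)
  show "cinner (x + y) z = cinner x z + cinner y z"
    by (simp add: cinner_complex_def distrib_right)
  show "cinner (scaleC a x) y = a * cinner x y"
    by (simp add: cinner_complex_def scaleC_complex_def mult.assoc)
  show "cinner x x = complex_of_real ((norm x)\<^sup>2)"
    unfolding cinner_complex_def by (rule complex_norm_square [symmetric])
qed

end

section \<open>Groups\<close>

definition finitely_generated_group :: "('g, 'x) monoid_scheme \<Rightarrow> bool"
  where "finitely_generated_group G \<longleftrightarrow>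
    group G \<and> (\<exists>S. finite S \<and> S \<subseteq> carrier G \<and> generate G S = carrier G)"

definition conjugacy_class :: "('g, 'x) monoid_scheme \<Rightarrow> 'g \<Rightarrow> 'g set"
  where "conjugacy_class G g = {h \<otimes>\<^bsub>G\<^esub> g \<otimes>\<^bsub>G\<^esub> inv\<^bsub>G\<^esub> h | h. h \<in> carrier G}"

definition conjugacy_classes :: "('g, 'x) monoid_scheme \<Rightarrow> 'g set set"
  where "conjugacy_classes G = conjugacy_class G ` carrier G"

section \<open>Unitary representations\<close>

definition unitary_operator :: "('h::complex_hilbert_space \<Rightarrow> 'h) \<Rightarrow> bool"
  where "unitary_operator U \<longleftrightarrow>
    (\<forall>x y. U (x + y) = U x + U y) \<and>
    (\<forall>a x. U (scaleC a x) = scaleC a (U x)) \<and>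
    (\<forall>x y. cinner (U x) (U y) = cinner x y) \<and>
    surj U"

definition unitary_representation ::
    "('g, 'x) monoid_scheme \<Rightarrow> ('g \<Rightarrow> 'h::complex_hilbert_space \<Rightarrow> 'h) \<Rightarrow> bool"
  where "unitary_representation G \<pi> \<longleftrightarrow>
    (\<forall>g\<in>carrier G. unitary_operator (\<pi> g)) \<and>
    (\<forall>g\<in>carrier G. \<forall>h\<in>carrier G. \<pi> (g \<otimes>\<^bsub>G\<^esub> h) = \<pi> g \<circ> \<pi> h)"

definition C0_function :: "'g set \<Rightarrow> ('g \<Rightarrow> complex) \<Rightarrow> bool"
  where "C0_function A f \<longleftrightarrow>
    (\<forall>\<epsilon>>0. \<exists>F. finite F \<and> F \<subseteq> A \<and> (\<forall>g\<in>A - F. cmod (f g) < \<epsilon>))"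

definition C0_representation ::
    "('g, 'x) monoid_scheme \<Rightarrow> ('g \<Rightarrow> 'h::complex_hilbert_space \<Rightarrow> 'h) \<Rightarrow> bool"
  where "C0_representation G \<pi> \<longleftrightarrow>
    unitary_representation G \<pi> \<and> (\<forall>x y. C0_function (carrier G) (\<lambda>g. cinner (\<pi> g x) y))"

section \<open>Reduced first cohomology\<close>

text \<open>Maps on \<open>carrier G\<close> are represented by elements of \<open>extensional (carrier G)\<close>, so that
  equality of such functions is equality of maps on the group.\<close>

definition cocycles ::
    "('g, 'x) monoid_scheme \<Rightarrow> ('g \<Rightarrow> 'h::complex_hilbert_space \<Rightarrow> 'h) \<Rightarrow> ('g \<Rightarrow> 'h) set"
  where "cocycles G \<pi> = {b \<in> extensional (carrier G).
    \<forall>g\<in>carrier G. \<forall>h\<in>carrier G. b (g \<otimes>\<^bsub>G\<^esub> h) = \<pi> g (b h) + b g}"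

definition coboundaries ::
    "('g, 'x) monoid_scheme \<Rightarrow> ('g \<Rightarrow> 'h::complex_hilbert_space \<Rightarrow> 'h) \<Rightarrow> ('g \<Rightarrow> 'h) set"
  where "coboundaries G \<pi> = {(\<lambda>g\<in>carrier G. \<pi> g v - v) | v. True}"

text \<open>Topology on maps \<open>A \<rightarrow> 'b\<close> of uniform convergence on the finite subsets of \<open>A\<close>, i.e. on the
  compact subsets when \<open>A\<close> is discrete.\<close>

definition finite_uniform_nhd ::
    "'a set \<Rightarrow> 'a set \<Rightarrow> real \<Rightarrow> ('a \<Rightarrow> 'b::metric_space) \<Rightarrow> ('a \<Rightarrow> 'b) set"
  where "finite_uniform_nhd A K \<epsilon> f = {f' \<in> extensional A. \<forall>x\<in>K. dist (f x) (f' x) < \<epsilon>}"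

definition finite_uniform_topology :: "'a set \<Rightarrow> ('a \<Rightarrow> 'b::metric_space) topology"
  where "finite_uniform_topology A = topology (\<lambda>U. U \<subseteq> extensional A \<and>
    (\<forall>f\<in>U. \<exists>K \<epsilon>. finite K \<and> K \<subseteq> A \<and> \<epsilon> > 0 \<and> finite_uniform_nhd A K \<epsilon> f \<subseteq> U))"

lemma openin_finite_uniform_topology:
  fixes U :: "('a \<Rightarrow> 'b::metric_space) set"
  shows "openin (finite_uniform_topology A) U \<longleftrightarrow> U \<subseteq> extensional A \<and>
    (\<forall>f\<in>U. \<exists>K \<epsilon>. finite K \<and> K \<subseteq> A \<and> \<epsilon> > 0 \<and> finite_uniform_nhd A K \<epsilon> f \<subseteq> U)"
proof -
  define Q where "Q f U \<longleftrightarrow>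
    (\<exists>K \<epsilon>. finite K \<and> K \<subseteq> A \<and> \<epsilon> > 0 \<and> finite_uniform_nhd A K \<epsilon> f \<subseteq> U)"
    for f and U :: "('a \<Rightarrow> 'b) set"
  have Q_mono: "Q f T" if "Q f S" "S \<subseteq> T" for f S T
    using that unfolding Q_def by (meson subset_trans)
  have Q_inter: "Q f (S \<inter> T)" if S: "Q f S" and T: "Q f T" for f S T
  proof -
    obtain K e where K: "finite K" "K \<subseteq> A" "e > 0" "finite_uniform_nhd A K e f \<subseteq> S"
      using S unfolding Q_def by blast
    obtain L d where L: "finite L" "L \<subseteq> A" "d > 0" "finite_uniform_nhd A L d f \<subseteq> T"
      using T unfolding Q_def by blast
    have "finite_uniform_nhd A (K \<union> L) (min e d) f \<subseteq>
        finite_uniform_nhd A K e f \<inter> finite_uniform_nhd A L d f"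
      by (auto simp: finite_uniform_nhd_def)
    then have "finite_uniform_nhd A (K \<union> L) (min e d) f \<subseteq> S \<inter> T"
      using K(4) L(4) by blast
    then show ?thesis
      unfolding Q_def using K(1-3) L(1-3)
      by (intro exI[of _ "K \<union> L"] exI[of _ "min e d"]) simp
  qed
  have "istopology (\<lambda>U. U \<subseteq> extensional A \<and> (\<forall>f\<in>U. Q f U))"
    unfolding istopology_def
  proof (intro conjI allI impI ballI)
    fix S T f
    assume "S \<subseteq> extensional A \<and> (\<forall>f\<in>S. Q f S)" "T \<subseteq> extensional A \<and> (\<forall>f\<in>T. Q f T)"
      "f \<in> S \<inter> T"
    then show "Q f (S \<inter> T)" by (simp add: Q_inter)
  next
    fix \<K> f
    assume *: "\<forall>S\<in>\<K>. S \<subseteq> extensional A \<and> (\<forall>f\<in>S. Q f S)" and "f \<in> \<Union>\<K>"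
    then obtain S where S: "S \<in> \<K>" "f \<in> S" by (elim UnionE)
    then have "Q f S" using * by simp
    then show "Q f (\<Union>\<K>)" using S(1) by (rule Q_mono[OF _ Union_upper])
  qed (simp_all add: Sup_le_iff le_infI1)
  then show ?thesis
    unfolding finite_uniform_topology_def Q_def by (simp only: topology_inverse')
qed

text \<open>The cocycles under pointwise addition, and the quotient by the closure of the coboundaries in
  the space of cocycles. The scalar action is omitted: it does not affect whether the quotient
  vanishes.\<close>

definition cocycle_group ::
    "('g, 'x) monoid_scheme \<Rightarrow> ('g \<Rightarrow> 'h::complex_hilbert_space \<Rightarrow> 'h) \<Rightarrow> ('g \<Rightarrow> 'h) monoid"
  where "cocycle_group G \<pi> = \<lparr>carrier = cocycles G \<pi>,
    monoid.mult = (\<lambda>b c. \<lambda>g\<in>carrier G. b g + c g), one = (\<lambda>g\<in>carrier G. 0)\<rparr>"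

definition coboundaries_closure ::
    "('g, 'x) monoid_scheme \<Rightarrow> ('g \<Rightarrow> 'h::complex_hilbert_space \<Rightarrow> 'h) \<Rightarrow> ('g \<Rightarrow> 'h) set"
  where "coboundaries_closure G \<pi> =
    subtopology (finite_uniform_topology (carrier G)) (cocycles G \<pi>) closure_of coboundaries G \<pi>"

definition reduced_H1 ::
    "('g, 'x) monoid_scheme \<Rightarrow> ('g \<Rightarrow> 'h::complex_hilbert_space \<Rightarrow> 'h) \<Rightarrow> ('g \<Rightarrow> 'h) set monoid"
  where "reduced_H1 G \<pi> = cocycle_group G \<pi> Mod coboundaries_closure G \<pi>"

end

theory Submission
  imports Defs
begin

text \<open>
  Let \<open>b\<close> be a cocycle. For a finite conjugacy class \<open>C\<close>, let \<open>M\<close> be the average of the operators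
  \<open>\<pi> c\<close> and \<open>A\<close> the average of the vectors \<open>b c\<close>, over \<open>c \<in> C\<close>. The sum of \<open>b\<close> over \<open>C\<close> is unchanged
  by conjugation, and expanding \<open>b (g c g\<inverse>)\<close> by the cocycle rule turns this into
  \<open>M (b g) = b g + (\<pi> g A - A)\<close> (\<open>average_over_class_cohomologous\<close>): the cocycle \<open>M \<circ> b\<close> is
  cohomologous to \<open>b\<close>.

  Conjugacy classes are disjoint, so infinitely many finite ones include a class that avoids any
  given finite set. As the coefficients of \<open>\<pi>\<close> are \<open>C\<^sub>0\<close>, \<open>M v\<close> can therefore be made almost orthogonal
  to any given vector (\<open>class_average_almost_orthogonal\<close>). It need not be small in norm, but a sum
  of \<open>n\<close> such averages, each chosen almost orthogonal to the sum of its predecessors, has norm of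
  order \<open>\<surd>n\<close> by Pythagoras. Hence the mean of \<open>n\<close> of them, which is still cohomologous to \<open>b\<close>, has
  norm of order \<open>1/\<surd>n\<close>, simultaneously at the points of a given finite set. So every cocycle is a
  limit of coboundaries.
\<close>

section \<open>Inner products and unitary operators\<close>

lemma cinner_zero_left: "cinner 0 (z::'h::complex_inner) = 0"
  using cinner_add_left[of 0 0 z] by simp

lemma cinner_sum_left: "cinner (sum f A) (z::'h::complex_inner) = (\<Sum>a\<in>A. cinner (f a) z)"
  by (induction A rule: infinite_finite_induct) (simp_all add: cinner_zero_left cinner_add_left)

lemma cinner_scaleR_left: "cinner (r *\<^sub>R x) (y::'h::complex_inner) = of_real r * cinner x y"
  by (metis scaleC_of_real cinner_scaleC_left)

lemma cinner_add_right: "cinner (x::'h::complex_inner) (y + z) = cinner x y + cinner x z"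
  by (metis cinner_commute cinner_add_left complex_cnj_add)

lemma norm_add_squared:
  fixes x y :: "'h::complex_inner"
  shows "(norm (x + y))\<^sup>2 = (norm x)\<^sup>2 + 2 * Re (cinner x y) + (norm y)\<^sup>2"
proof -
  have "Re (cinner y x) = Re (cinner x y)"
    by (subst cinner_commute) simp
  moreover have norm: "(norm z)\<^sup>2 = Re (cinner z z)" for z :: 'h
    by (simp add: cinner_self)
  ultimately show ?thesis
    by (simp add: cinner_add_left cinner_add_right norm)
qed

lemma unitary_operator_linear:
  assumes "unitary_operator U"
  shows "linear U"
proof
  show "U (x + y) = U x + U y" for x y
    using assms by (simp add: unitary_operator_def)
  show "U (r *\<^sub>R x) = r *\<^sub>R U x" for r x
    using assms by (metis unitary_operator_def scaleC_of_real)
qed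

lemma unitary_operator_norm:
  assumes "unitary_operator U"
  shows "norm (U x) = norm x"
proof -
  have "complex_of_real ((norm (U x))\<^sup>2) = complex_of_real ((norm x)\<^sup>2)"
    using assms by (simp only: unitary_operator_def flip: cinner_self)
  then show ?thesis
    by (simp only: of_real_eq_iff) simp
qed

section \<open>Conjugacy classes\<close>

lemma (in group) conjugacy_class_subset:
  "g \<in> carrier G \<Longrightarrow> conjugacy_class G g \<subseteq> carrier G"
  by (auto simp: conjugacy_class_def)

lemma (in group) self_in_conjugacy_class:
  "g \<in> carrier G \<Longrightarrow> g \<in> conjugacy_class G g"
  unfolding conjugacy_class_def by (force intro: exI[of _ \<one>])

lemma (in group) conjugate_conjugate:
  assumes "x \<in> carrier G" "h \<in> carrier G" "k \<in> carrier G"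
  shows "k \<otimes> (h \<otimes> x \<otimes> inv h) \<otimes> inv k = (k \<otimes> h) \<otimes> x \<otimes> inv (k \<otimes> h)"
  using assms by (simp add: m_assoc inv_mult_group)

lemma (in group) conjugacy_class_closed:
  assumes "a \<in> carrier G" "c \<in> conjugacy_class G a" "g \<in> carrier G"
  shows "g \<otimes> c \<otimes> inv g \<in> conjugacy_class G a"
  using assms unfolding conjugacy_class_def by (auto simp: conjugate_conjugate)

lemma (in group) conjugacy_class_eq:
  assumes a: "a \<in> carrier G" and c: "c \<in> conjugacy_class G a"
  shows "conjugacy_class G c = conjugacy_class G a"
proof
  obtain h where h: "h \<in> carrier G" "c = h \<otimes> a \<otimes> inv h"
    using c by (auto simp: conjugacy_class_def)
  show "conjugacy_class G c \<subseteq> conjugacy_class G a"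
    using conjugacy_class_closed[OF a c] by (auto simp: conjugacy_class_def[of G c])
  have "a = inv h \<otimes> c \<otimes> inv (inv h)"
    using a h conjugate_conjugate[of a h "inv h"] by simp
  then have "a \<in> conjugacy_class G c"
    using h(1) unfolding conjugacy_class_def by blast
  moreover have "c \<in> carrier G"
    using a h by simp
  ultimately show "conjugacy_class G a \<subseteq> conjugacy_class G c"
    using conjugacy_class_closed by (auto simp: conjugacy_class_def[of G a])
qed

text \<open>Each point of \<open>F\<close> lies in only one class, so only finitely many classes meet \<open>F\<close>.\<close>

lemma (in group) finite_conjugacy_class_avoiding:
  assumes inf: "infinite {C \<in> conjugacy_classes G. finite C}" and F: "finite F"
  obtains a where "a \<in> carrier G" "finite (conjugacy_class G a)" "conjugacy_class G a \<inter> F = {}"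
proof -
  have "\<not> {C \<in> conjugacy_classes G. finite C} \<subseteq> conjugacy_class G ` F"
    using inf F finite_surj by blast
  then obtain a where a: "a \<in> carrier G" "finite (conjugacy_class G a)"
    "conjugacy_class G a \<notin> conjugacy_class G ` F"
    by (auto simp: conjugacy_classes_def)
  have "c \<notin> F" if "c \<in> conjugacy_class G a" for c
    using conjugacy_class_eq[OF a(1) that] a(3) by (metis imageI)
  then show ?thesis
    using that a by blast
qed

lemma (in group) sum_conjugate_class:
  assumes a: "a \<in> carrier G" and fin: "finite (conjugacy_class G a)" and g: "g \<in> carrier G"
  shows "(\<Sum>c\<in>conjugacy_class G a. f (g \<otimes> c \<otimes> inv g)) = sum f (conjugacy_class G a)"
proof -
  let ?C = "conjugacy_class G a" and ?\<phi> = "\<lambda>c. g \<otimes> c \<otimes> inv g"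
  have "inj_on ?\<phi> ?C"
    using conjugacy_class_subset[OF a] g by (intro inj_onI) (simp add: subset_iff)
  moreover have "?\<phi> ` ?C \<subseteq> ?C"
    using conjugacy_class_closed[OF a _ g] by blast
  ultimately have "bij_betw ?\<phi> ?C ?C"
    using fin by (simp add: bij_betw_def endo_inj_surj)
  then show ?thesis
    by (rule sum.reindex_bij_betw)
qed

section \<open>Averaging over a finite conjugacy class\<close>

definition class_average :: "'g set \<Rightarrow> ('g \<Rightarrow> 'h::real_vector) \<Rightarrow> 'h"
  where "class_average C f = (1 / real (card C)) *\<^sub>R sum f C"

lemma norm_class_average_le:
  fixes f :: "'g \<Rightarrow> 'h::real_normed_vector"
  assumes "finite C" "C \<noteq> {}" "\<And>c. c \<in> C \<Longrightarrow> norm (f c) \<le> B"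
  shows "norm (class_average C f) \<le> B"
proof -
  have "norm (sum f C) \<le> real (card C) * B"
    using sum_norm_le[of C f "\<lambda>_. B"] assms(3) by simp
  moreover have "card C > 0"
    using assms(1,2) by (simp add: card_gt_0_iff)
  ultimately show ?thesis
    by (simp add: class_average_def field_simps)
qed

lemma cinner_class_average:
  "cinner (class_average C f) (w::'h::complex_inner) = class_average C (\<lambda>c. cinner (f c) w)"
  by (simp add: class_average_def cinner_scaleR_left cinner_sum_left scaleR_conv_of_real)

text \<open>The two evaluations of \<open>b\<close> at \<open>(g c g\<inverse>) g = g c\<close> give
  \<open>b (g c g\<inverse>) = b g + \<pi> g (b c) - \<pi> (g c g\<inverse>) (b g)\<close>; conjugation by \<open>g\<close> permutes the class, so it
  disappears on averaging over \<open>c\<close>.\<close>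

lemma average_over_class_cohomologous:
  fixes \<pi> :: "'g \<Rightarrow> 'h::complex_hilbert_space \<Rightarrow> 'h" and a :: 'g
  assumes "group G" and rep: "unitary_representation G \<pi>" and b: "b \<in> cocycles G \<pi>"
    and a: "a \<in> carrier G" and fin: "finite (conjugacy_class G a)" and g: "g \<in> carrier G"
  defines "C \<equiv> conjugacy_class G a"
  shows "class_average C (\<lambda>c. \<pi> c (b g)) = b g + (\<pi> g (class_average C b) - class_average C b)"
proof -
  interpret group G by fact
  have lin: "linear (\<pi> g)"
    using rep g by (simp add: unitary_representation_def unitary_operator_linear)
  have sub: "C \<subseteq> carrier G"
    unfolding C_def using a by (rule conjugacy_class_subset)
  have "a \<in> C"
    unfolding C_def using a by (rule self_in_conjugacy_class)
  then have card: "card C > 0"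
    using fin by (auto simp: card_gt_0_iff C_def)
  have cocycle: "b (x \<otimes>\<^bsub>G\<^esub> y) = \<pi> x (b y) + b x" if "x \<in> carrier G" "y \<in> carrier G" for x y
    using b that by (simp add: cocycles_def)
  let ?k = "\<lambda>c. g \<otimes>\<^bsub>G\<^esub> c \<otimes>\<^bsub>G\<^esub> inv\<^bsub>G\<^esub> g"
  have "\<pi> (?k c) (b g) + b (?k c) = \<pi> g (b c) + b g" if "c \<in> C" for c
  proof -
    have c: "c \<in> carrier G"
      using sub that by blast
    have "?k c \<otimes>\<^bsub>G\<^esub> g = g \<otimes>\<^bsub>G\<^esub> c"
      using c g by (simp add: m_assoc)
    then show ?thesis
      using c g cocycle[of "?k c" g] cocycle[of g c] by simp
  qed
  then have "(\<Sum>c\<in>C. \<pi> (?k c) (b g) + b (?k c)) = (\<Sum>c\<in>C. \<pi> g (b c) + b g)"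
    by simp
  then have "(\<Sum>c\<in>C. \<pi> c (b g)) + sum b C = \<pi> g (sum b C) + real (card C) *\<^sub>R b g"
    using sum_conjugate_class[OF a fin g, of "\<lambda>c. \<pi> c (b g) + b c"]
    by (simp add: C_def sum.distrib linear_sum[OF lin] sum_constant_scaleR)
  then have "(\<Sum>c\<in>C. \<pi> c (b g)) = \<pi> g (sum b C) + real (card C) *\<^sub>R b g - sum b C"
    by (simp add: algebra_simps)
  then show ?thesis
    using card by (simp add: class_average_def linear_scale[OF lin] scaleR_add_right scaleR_diff_right)
qed

text \<open>The exceptional finite sets of the coefficients involved are all avoided by a suitable class,
  and an average of small numbers is small.\<close>

lemma class_average_almost_orthogonal:
  fixes \<pi> :: "'g \<Rightarrow> 'h::complex_hilbert_space \<Rightarrow> 'h" and v w :: "'i \<Rightarrow> 'h"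
  assumes "group G" and inf: "infinite {C \<in> conjugacy_classes G. finite C}"
    and C0: "C0_representation G \<pi>" and K: "finite K" and "\<epsilon> > 0"
  obtains a where "a \<in> carrier G" "finite (conjugacy_class G a)"
    "\<And>i. i \<in> K \<Longrightarrow> cmod (cinner (class_average (conjugacy_class G a) (\<lambda>c. \<pi> c (v i))) (w i)) \<le> \<epsilon>"
proof -
  interpret group G by fact
  have "\<exists>F. finite F \<and> (\<forall>g\<in>carrier G - F. cmod (cinner (\<pi> g (v i)) (w i)) < \<epsilon>)" for i
    using C0 \<open>\<epsilon> > 0\<close> unfolding C0_representation_def C0_function_def by meson
  then obtain F where F: "\<And>i. finite (F i)"
    "\<And>i g. g \<in> carrier G - F i \<Longrightarrow> cmod (cinner (\<pi> g (v i)) (w i)) < \<epsilon>"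
    by metis
  have "finite (\<Union>i\<in>K. F i)"
    using K F(1) by blast
  then obtain a where a: "a \<in> carrier G" "finite (conjugacy_class G a)"
    "conjugacy_class G a \<inter> (\<Union>i\<in>K. F i) = {}"
    by (rule finite_conjugacy_class_avoiding[OF inf])
  have "cmod (cinner (class_average (conjugacy_class G a) (\<lambda>c. \<pi> c (v i))) (w i)) \<le> \<epsilon>"
    if "i \<in> K" for i
    unfolding cinner_class_average
  proof (rule norm_class_average_le)
    fix c assume "c \<in> conjugacy_class G a"
    then have "c \<in> carrier G - F i"
      using a conjugacy_class_subset[OF a(1)] that by blast
    then show "cmod (cinner (\<pi> c (v i)) (w i)) \<le> \<epsilon>"
      using F(2) less_imp_le by blast
  qed (use a self_in_conjugacy_class in auto)
  then show ?thesis
    using that a by blast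
qed

section \<open>Approximation by coboundaries\<close>

text \<open>With \<open>u\<close> the sum of the vectors \<open>A\<close> of \<open>n\<close> classes, \<open>n *\<^sub>R b g + (\<pi> g u - u)\<close> is the sum of the
  corresponding averages \<open>M (b g)\<close>. The next average adds at most \<open>(norm (b g))\<^sup>2\<close> to the squared
  norm, apart from a cross term, which the choice of the class makes at most \<open>1\<close>.\<close>

lemma multiple_of_cocycle_cohomologous_to_small:
  fixes \<pi> :: "'g \<Rightarrow> 'h::complex_hilbert_space \<Rightarrow> 'h"
  assumes "group G" and inf: "infinite {C \<in> conjugacy_classes G. finite C}"
    and C0: "C0_representation G \<pi>" and b: "b \<in> cocycles G \<pi>"
    and K: "finite K" "K \<subseteq> carrier G"
  shows "\<exists>u. \<forall>g\<in>K. (norm (real n *\<^sub>R b g + (\<pi> g u - u)))\<^sup>2 \<le> real n * ((norm (b g))\<^sup>2 + 1)"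
proof (induction n)
  case 0
  have "\<pi> g 0 = 0" if "g \<in> K" for g
    using C0 K that by (auto simp: C0_representation_def unitary_representation_def
        intro!: linear_0 unitary_operator_linear)
  then show ?case
    by (intro exI[of _ 0]) simp
next
  case (Suc n)
  interpret group G by fact
  have rep: "unitary_representation G \<pi>"
    using C0 by (simp add: C0_representation_def)
  define r where "r u g = real n *\<^sub>R b g + (\<pi> g u - u)" for u g
  from Suc obtain u where u: "\<And>g. g \<in> K \<Longrightarrow> (norm (r u g))\<^sup>2 \<le> real n * ((norm (b g))\<^sup>2 + 1)"
    by (auto simp: r_def)
  obtain a where a: "a \<in> carrier G" "finite (conjugacy_class G a)"
    and orth: "\<And>g. g \<in> K \<Longrightarrow>
      cmod (cinner (class_average (conjugacy_class G a) (\<lambda>c. \<pi> c (b g))) (r u g)) \<le> 1 / 2"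
    by (rule class_average_almost_orthogonal[OF \<open>group G\<close> inf C0 K(1),
          where \<epsilon> = "1/2" and v = b and w = "r u"]) auto
  define A where "A = class_average (conjugacy_class G a) b"
  have "(norm (real (Suc n) *\<^sub>R b g + (\<pi> g (u + A) - (u + A))))\<^sup>2
      \<le> real (Suc n) * ((norm (b g))\<^sup>2 + 1)" if gK: "g \<in> K" for g
  proof -
    have g: "g \<in> carrier G"
      using gK K by blast
    have lin: "linear (\<pi> g)"
      using rep g by (simp add: unitary_representation_def unitary_operator_linear)
    define m where "m = class_average (conjugacy_class G a) (\<lambda>c. \<pi> c (b g))"
    have "m = b g + (\<pi> g A - A)"
      unfolding m_def A_def using \<open>group G\<close> rep b a g by (rule average_over_class_cohomologous)
    then have sum: "real (Suc n) *\<^sub>R b g + (\<pi> g (u + A) - (u + A)) = m + r u g"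
      by (simp add: r_def linear_add[OF lin] algebra_simps)
    have "norm m \<le> norm (b g)"
      unfolding m_def
    proof (rule norm_class_average_le)
      fix c assume "c \<in> conjugacy_class G a"
      then have "c \<in> carrier G"
        using conjugacy_class_subset[OF a(1)] by blast
      then show "norm (\<pi> c (b g)) \<le> norm (b g)"
        using rep by (simp add: unitary_representation_def unitary_operator_norm)
    qed (use a self_in_conjugacy_class in auto)
    then have "(norm m)\<^sup>2 \<le> (norm (b g))\<^sup>2"
      by (rule power_mono) simp
    moreover have "Re (cinner m (r u g)) \<le> 1 / 2"
      using orth[OF gK] complex_Re_le_cmod[of "cinner m (r u g)"] by (simp add: m_def)
    moreover have "real (Suc n) * ((norm (b g))\<^sup>2 + 1)
        = real n * ((norm (b g))\<^sup>2 + 1) + (norm (b g))\<^sup>2 + 1"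
      by (simp add: algebra_simps)
    ultimately show ?thesis
      unfolding sum norm_add_squared using u[OF gK] by linarith
  qed
  then show ?case
    by blast
qed

lemma cocycle_approximable_by_coboundaries:
  fixes \<pi> :: "'g \<Rightarrow> 'h::complex_hilbert_space \<Rightarrow> 'h"
  assumes "group G" and inf: "infinite {C \<in> conjugacy_classes G. finite C}"
    and C0: "C0_representation G \<pi>" and b: "b \<in> cocycles G \<pi>"
    and K: "finite K" "K \<subseteq> carrier G" and \<epsilon>: "\<epsilon> > 0"
  shows "\<exists>v. \<forall>g\<in>K. dist (b g) (\<pi> g v - v) < \<epsilon>"
proof -
  define B where "B = (\<Sum>g\<in>K. (norm (b g))\<^sup>2) + 1"
  have B: "(norm (b g))\<^sup>2 + 1 \<le> B" if "g \<in> K" for g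
    unfolding B_def using member_le_sum[of g K "\<lambda>g. (norm (b g))\<^sup>2"] that K by simp
  \<comment> \<open>Dividing a vector of norm at most \<open>sqrt (n B)\<close> by \<open>n\<close> leaves \<open>sqrt (B / n)\<close>, to be below \<open>\<epsilon>\<close>.\<close>
  obtain n where n: "real n > B / \<epsilon>\<^sup>2"
    using reals_Archimedean2 by blast
  have "B > 0"
    unfolding B_def by (simp add: sum_nonneg add_nonneg_pos)
  then have "real n > 0"
    using n \<epsilon> by (meson divide_pos_pos less_trans zero_less_power)
  have nB: "B < real n * \<epsilon>\<^sup>2"
    using n \<epsilon> by (simp add: field_simps)
  obtain u where u: "\<And>g. g \<in> K \<Longrightarrow>
      (norm (real n *\<^sub>R b g + (\<pi> g u - u)))\<^sup>2 \<le> real n * ((norm (b g))\<^sup>2 + 1)"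
    using multiple_of_cocycle_cohomologous_to_small[OF assms(1-6)] by blast
  define v where "v = (- 1 / real n) *\<^sub>R u"
  have "dist (b g) (\<pi> g v - v) < \<epsilon>" if gK: "g \<in> K" for g
  proof -
    have "linear (\<pi> g)"
      using C0 K gK by (auto simp: C0_representation_def unitary_representation_def
          intro!: unitary_operator_linear)
    then have "real n *\<^sub>R (b g - (\<pi> g v - v)) = real n *\<^sub>R b g + (\<pi> g u - u)"
      using \<open>real n > 0\<close> by (simp add: v_def linear_scale linear_neg algebra_simps)
    then have "norm (real n *\<^sub>R b g + (\<pi> g u - u)) = real n * dist (b g) (\<pi> g v - v)"
      by (metis dist_norm norm_scaleR abs_of_nat)
    then have "(real n * dist (b g) (\<pi> g v - v))\<^sup>2 \<le> real n * B"
      using u[OF gK] B[OF gK] by (metis mult_left_mono of_nat_0_le_iff order_trans)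
    also have "\<dots> < real n * (real n * \<epsilon>\<^sup>2)"
      using nB \<open>real n > 0\<close> by simp
    also have "\<dots> = (real n * \<epsilon>)\<^sup>2"
      by (simp add: power2_eq_square)
    finally have square: "(real n * dist (b g) (\<pi> g v - v))\<^sup>2 < (real n * \<epsilon>)\<^sup>2" .
    have "0 \<le> real n * \<epsilon>"
      using \<epsilon> by (intro mult_nonneg_nonneg) linarith+
    with square have "real n * dist (b g) (\<pi> g v - v) < real n * \<epsilon>"
      by (rule power2_less_imp_less)
    then show ?thesis
      using \<open>real n > 0\<close> by (simp only: mult_less_cancel_left_pos)
  qed
  then show ?thesis
    by (intro exI[of _ v]) simp
qed

section \<open>The quotient of cocycles by the closure of coboundaries\<close>

lemma coboundary_cocycle:
  assumes "group G" and rep: "unitary_representation G \<pi>"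
  shows "coboundaries G \<pi> \<subseteq> cocycles G \<pi>"
proof -
  interpret group G by fact
  have "linear (\<pi> g)" if "g \<in> carrier G" for g
    using rep that by (simp add: unitary_representation_def unitary_operator_linear)
  then show ?thesis
    using rep by (auto simp: coboundaries_def cocycles_def unitary_representation_def linear_diff)
qed

lemma group_cocycle_group:
  fixes \<pi> :: "'g \<Rightarrow> 'h::complex_hilbert_space \<Rightarrow> 'h"
  assumes "group G" and rep: "unitary_representation G \<pi>"
  shows "group (cocycle_group G \<pi>)"
proof -
  interpret group G by fact
  have lin: "linear (\<pi> g)" if "g \<in> carrier G" for g
    using rep that by (simp add: unitary_representation_def unitary_operator_linear)
  note defs = cocycle_group_def cocycles_def
  show ?thesis
  proof (rule groupI)
    fix b c assume "b \<in> carrier (cocycle_group G \<pi>)" "c \<in> carrier (cocycle_group G \<pi>)"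
    then show "b \<otimes>\<^bsub>cocycle_group G \<pi>\<^esub> c \<in> carrier (cocycle_group G \<pi>)"
      by (simp add: defs linear_add[OF lin])
  next
    show "\<one>\<^bsub>cocycle_group G \<pi>\<^esub> \<in> carrier (cocycle_group G \<pi>)"
      by (simp add: defs linear_0[OF lin])
  next
    fix b c d :: "'g \<Rightarrow> 'h"
    show "b \<otimes>\<^bsub>cocycle_group G \<pi>\<^esub> c \<otimes>\<^bsub>cocycle_group G \<pi>\<^esub> d
        = b \<otimes>\<^bsub>cocycle_group G \<pi>\<^esub> (c \<otimes>\<^bsub>cocycle_group G \<pi>\<^esub> d)"
      by (simp add: defs add.assoc cong: restrict_cong)
  next
    fix b assume b: "b \<in> carrier (cocycle_group G \<pi>)"
    then show "\<one>\<^bsub>cocycle_group G \<pi>\<^esub> \<otimes>\<^bsub>cocycle_group G \<pi>\<^esub> b = b"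
      by (simp add: defs extensional_restrict cong: restrict_cong)
    show "\<exists>c\<in>carrier (cocycle_group G \<pi>).
        c \<otimes>\<^bsub>cocycle_group G \<pi>\<^esub> b = \<one>\<^bsub>cocycle_group G \<pi>\<^esub>"
    proof
      show "(\<lambda>g\<in>carrier G. - b g) \<in> carrier (cocycle_group G \<pi>)"
        using b by (simp add: defs linear_neg[OF lin])
    qed (simp add: defs cong: restrict_cong)
  qed
qed

lemma topspace_finite_uniform_topology:
  "topspace (finite_uniform_topology A) = extensional A"
proof
  show "topspace (finite_uniform_topology A) \<subseteq> extensional A"
    by (auto simp: topspace_def openin_finite_uniform_topology)
  show "extensional A \<subseteq> topspace (finite_uniform_topology A)"
    by (intro openin_subset)
      (auto simp: openin_finite_uniform_topology finite_uniform_nhd_def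
        intro!: exI[of _ "{}"] exI[of _ "1::real"])
qed

lemma coboundaries_dense:
  fixes \<pi> :: "'g \<Rightarrow> 'h::complex_hilbert_space \<Rightarrow> 'h"
  assumes "group G" and inf: "infinite {C \<in> conjugacy_classes G. finite C}"
    and C0: "C0_representation G \<pi>"
  shows "coboundaries_closure G \<pi> = cocycles G \<pi>"
proof
  have top: "topspace (subtopology (finite_uniform_topology (carrier G)) (cocycles G \<pi>))
      = cocycles G \<pi>"
    by (auto simp: topspace_finite_uniform_topology cocycles_def)
  then show "coboundaries_closure G \<pi> \<subseteq> cocycles G \<pi>"
    unfolding coboundaries_closure_def by (metis closure_of_subset_topspace)
  show "cocycles G \<pi> \<subseteq> coboundaries_closure G \<pi>"
  proof
    fix b assume b: "b \<in> cocycles G \<pi>"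
    have "\<exists>c\<in>coboundaries G \<pi>. c \<in> T"
      if "b \<in> T" and T: "openin (subtopology (finite_uniform_topology (carrier G)) (cocycles G \<pi>)) T"
      for T
    proof -
      obtain U where U: "openin (finite_uniform_topology (carrier G)) U" "T = U \<inter> cocycles G \<pi>"
        using T by (auto simp: openin_subtopology)
      then obtain K \<epsilon> where K: "finite K" "K \<subseteq> carrier G" "\<epsilon> > 0"
        "finite_uniform_nhd (carrier G) K \<epsilon> b \<subseteq> U"
        using \<open>b \<in> T\<close> by (auto simp: openin_finite_uniform_topology)
      obtain v where v: "\<And>g. g \<in> K \<Longrightarrow> dist (b g) (\<pi> g v - v) < \<epsilon>"
        using cocycle_approximable_by_coboundaries[OF assms b K(1-3)] by blast
      let ?c = "\<lambda>g\<in>carrier G. \<pi> g v - v"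
      have "?c \<in> coboundaries G \<pi>"
        by (auto simp: coboundaries_def)
      moreover have "?c \<in> finite_uniform_nhd (carrier G) K \<epsilon> b"
        using v K(2) by (auto simp: finite_uniform_nhd_def subset_iff)
      ultimately show ?thesis
        using K(4) U(2) coboundary_cocycle[OF \<open>group G\<close>] C0
        by (auto simp: C0_representation_def)
    qed
    then show "b \<in> coboundaries_closure G \<pi>"
      unfolding coboundaries_closure_def in_closure_of top using b by blast
  qed
qed

lemma (in group) trivial_group_Mod_carrier: "trivial_group (G Mod carrier G)"
proof -
  have "group (G Mod carrier G)"
    by (intro normal.factorgroup_is_group normal_self)
  moreover have "carrier (G Mod carrier G) = {carrier G}"
    using coset_join2[OF _ subgroup_self] by (auto simp: FactGroup_def RCOSETS_def)
  ultimately show ?thesis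
    by (simp add: trivial_group_def FactGroup_def)
qed

theorem proposition1p5:
  fixes G :: "('g, 'x) monoid_scheme"
    and \<pi> :: "'g \<Rightarrow> 'h::complex_hilbert_space \<Rightarrow> 'h"
  assumes "finitely_generated_group G"
    and "infinite {C \<in> conjugacy_classes G. finite C}"
    and "C0_representation G \<pi>"
  shows "trivial_group (reduced_H1 G \<pi>)"
proof -
  have G: "group G"
    using assms(1) by (simp add: finitely_generated_group_def)
  then interpret Z: group "cocycle_group G \<pi>"
    using assms(3) by (intro group_cocycle_group) (simp_all add: C0_representation_def)
  have "coboundaries_closure G \<pi> = carrier (cocycle_group G \<pi>)"
    using coboundaries_dense[OF G assms(2,3)] by (simp add: cocycle_group_def)
  then show ?thesis
    unfolding reduced_H1_def using Z.trivial_group_Mod_carrier by simp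
qed

end
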